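(* Let $\mathcal{P}^*$ be an equivalence class of $N$-polygons and let $\Gamma(t)$ ($t\in\mathcal{I}$, $\mathcal{I}\subset\mathbb{R}$ an interval) be a $C^1$-class polygonal motion in $\mathcal{P}^*$, with interior domain $\Omega(t)$ and normal velocity $V$. Then $$\frac{d}{dt}|\Omega(t)|=\int_{\Gamma(t)}V(\boldsymbol{x},t)\,ds=\sum_{j=1}^N|\Gamma_j(t)|\,V_j(t).$$
   Context: $\mathcal{P}$ is the set of all polygonal Jordan curves in $\mathbb{R}^2$. For an $N$-polygon $\Gamma\in\mathcal{P}$, the vertices $\boldsymbol{w}_1,\dots,\boldsymbol{w}_N$ are numbered counterclockwise (periodic index convention modulo $N$), the $j$-th edge is $\Gamma_j=\{(1-\theta)\boldsymbol{w}_{j-1}+\theta\boldsymbol{w}_j:0<\theta<1\}$ with length $|\Gamma_j|$ and outward unit normal $\boldsymbol{n}_j$, consecutive edges are not parallel (outer angle $\varphi_j\in(-\pi,\pi)\setminus\{0\}$ at $\boldsymbol{w}_j$), the height of $\Gamma_j$ is $h_j:=\boldsymbol{w}_j\cdot\boldsymbol{n}_j=\boldsymbol{w}_{j-1}\cdot\boldsymbol{n}_j$, and $\Omega$ is the bounded domain enclosed by $\Gamma$, with area $|\Omega|$. Two polygons are equivalent, $\Gamma\sim\Sigma$, if they have the same number $N$ of edges and, after suitable counterclockwise numbering, $\boldsymbol{n}_j(\Gamma)=\boldsymbol{n}_j(\Sigma)$ for all $j$. $\mathcal{P}^*=\mathcal{P}[\Gamma^*]$ is the equivalence class of a fixed $N$-polygon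 $\Gamma^*$, its elements being numbered so that $\boldsymbol n_j(\Gamma)=\boldsymbol n_j(\Gamma^* )$. A polygonal motion in $\mathcal{P}^*$ is a family $\Gamma(t)\in\mathcal{P}^*$, $t\in\mathcal{I}$; it is of $C^1$-class if all vertices satisfy $\boldsymbol{w}_j\in C^1(\mathcal{I};\mathbb{R}^2)$ (equivalently all heights $h_j(t)$ are $C^1$). The outward normal velocity at $(1-\theta)\boldsymbol{w}_{j-1}(t)+\theta\boldsymbol{w}_j(t)\in\Gamma_j(t)$ is $V_j=(1-\theta)\dot{\boldsymbol{w}}_{j-1}(t)\cdot\boldsymbol{n}_j+\theta\dot{\boldsymbol{w}}_j(t)\cdot\boldsymbol{n}_j$; for a polygonal motion in $\mathcal{P}^*$ it is constant on each edge and $V_j(t)=\dot h_j(t)$. The normal velocity of $\Gamma(t)$ is $V(\cdot,t)=\sum_{j=1}^N V_j(\cdot,t)\chi_j(\cdot,t)\in L^\infty(\Gamma(t))$, where $\chi_j(\cdot,t)$ is the characteristic function of $\Gamma_j(t)$ on $\Gamma(t)$; $ds$ is arc length. *)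

theory Defs
  imports "HOL-Analysis.Analysis" "HOL-Complex_Analysis.Complex_Analysis"
begin

text \<open>
  The plane is the type \<^typ>\<open>complex\<close>, with its real inner product.  A polygon is represented by
  a counterclockwise numbering \<open>w\<close> of its vertices; indices are integers, and the numbering is
  periodic modulo the number \<open>N\<close> of vertices.  Edge \<open>j\<close> runs from \<open>w (j - 1)\<close> to \<open>w j\<close>; the path below
  traverses it affinely for parameters between \<open>(j - 1) / N\<close> and \<open>j / N\<close>.
\<close>

definition polygon_path :: "nat \<Rightarrow> (int \<Rightarrow> complex) \<Rightarrow> real \<Rightarrow> complex" where
  "polygon_path N w s =
     (1 - frac (real N * s)) *\<^sub>R w \<lfloor>real N * s\<rfloor> + frac (real N * s) *\<^sub>R w (\<lfloor>real N * s\<rfloor> + 1)"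

definition polygon_curve :: "nat \<Rightarrow> (int \<Rightarrow> complex) \<Rightarrow> complex set" where
  "polygon_curve N w = path_image (polygon_path N w)"

definition is_polygon :: "nat \<Rightarrow> (int \<Rightarrow> complex) \<Rightarrow> bool" where
  "is_polygon N w \<longleftrightarrow>
     (\<forall>j. w (j + int N) = w j) \<and>
     simple_path (polygon_path N w) \<and>
     (\<forall>j. \<not> collinear {w (j - 1), w j, w (j + 1)}) \<and>
     (\<forall>z\<in>inside (polygon_curve N w). winding_number (polygon_path N w) z = 1)"

definition polygon_edge :: "(int \<Rightarrow> complex) \<Rightarrow> int \<Rightarrow> complex set" where
  "polygon_edge w j = open_segment (w (j - 1)) (w j)"

definition edge_length :: "(int \<Rightarrow> complex) \<Rightarrow> int \<Rightarrow> real" where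
  "edge_length w j = dist (w (j - 1)) (w j)"

definition outward_normal :: "nat \<Rightarrow> (int \<Rightarrow> complex) \<Rightarrow> int \<Rightarrow> complex" where
  "outward_normal N w j =
     (THE n. norm n = 1 \<and> n \<bullet> (w j - w (j - 1)) = 0 \<and>
        (\<forall>x\<in>polygon_edge w j. \<forall>\<^sub>F s in at_right 0. x + s *\<^sub>R n \<in> outside (polygon_curve N w)))"

text \<open>
  The equivalence class of the polygon \<open>w0\<close>: each polygon in it is represented by the
  counterclockwise numbering for which its normals agree index by index with those of \<open>w0\<close>.
\<close>

definition polygon_class :: "nat \<Rightarrow> (int \<Rightarrow> complex) \<Rightarrow> (int \<Rightarrow> complex) set" where
  "polygon_class N w0 = {w. is_polygon N w \<and> (\<forall>j. outward_normal N w j = outward_normal N w0 j)}"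

text \<open>
  Time derivatives are taken within \<open>I\<close>, hence are one-sided at the endpoints of \<open>I\<close> that belong to it.
\<close>

definition C1_polygonal_motion ::
    "real set \<Rightarrow> (int \<Rightarrow> complex) set \<Rightarrow> (real \<Rightarrow> int \<Rightarrow> complex) \<Rightarrow> bool" where
  "C1_polygonal_motion I P w \<longleftrightarrow>
     (\<forall>t\<in>I. w t \<in> P) \<and>
     (\<forall>j. \<exists>D. (\<forall>t\<in>I. ((\<lambda>s. w s j) has_vector_derivative D t) (at t within I)) \<and> continuous_on I D)"

definition vertex_velocity ::
    "real set \<Rightarrow> (real \<Rightarrow> int \<Rightarrow> complex) \<Rightarrow> int \<Rightarrow> real \<Rightarrow> complex" where
  "vertex_velocity I w j t = vector_derivative (\<lambda>s. w s j) (at t within I)"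

definition edge_param :: "(int \<Rightarrow> complex) \<Rightarrow> int \<Rightarrow> complex \<Rightarrow> real" where
  "edge_param w j x = (THE \<theta>. x = (1 - \<theta>) *\<^sub>R w (j - 1) + \<theta> *\<^sub>R w j)"

definition edge_velocity_at ::
    "nat \<Rightarrow> real set \<Rightarrow> (real \<Rightarrow> int \<Rightarrow> complex) \<Rightarrow> int \<Rightarrow> real \<Rightarrow> complex \<Rightarrow> real" where
  "edge_velocity_at N I w j t x =
     (let \<theta> = edge_param (w t) j x; n = outward_normal N (w t) j in
        (1 - \<theta>) * (vertex_velocity I w (j - 1) t \<bullet> n) + \<theta> * (vertex_velocity I w j t \<bullet> n))"

text \<open>
  For a motion within an equivalence class the velocity is constant along each edge;
  \<open>edge_velocity\<close> is that constant value.
\<close>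

definition edge_velocity ::
    "nat \<Rightarrow> real set \<Rightarrow> (real \<Rightarrow> int \<Rightarrow> complex) \<Rightarrow> int \<Rightarrow> real \<Rightarrow> real" where
  "edge_velocity N I w j t = (THE v. \<forall>x\<in>polygon_edge (w t) j. edge_velocity_at N I w j t x = v)"

definition normal_velocity ::
    "nat \<Rightarrow> real set \<Rightarrow> (real \<Rightarrow> int \<Rightarrow> complex) \<Rightarrow> real \<Rightarrow> complex \<Rightarrow> real" where
  "normal_velocity N I w t x =
     (\<Sum>j = 1..int N. edge_velocity_at N I w j t x * indicator (polygon_edge (w t) j) x)"

text \<open>
  Integral with respect to arc length along a piecewise smooth path, in the style of the
  library's contour integral.
\<close>

definition arclength_integral :: "(real \<Rightarrow> complex) \<Rightarrow> (complex \<Rightarrow> real) \<Rightarrow> real" where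
  "arclength_integral g f =
     integral {0..1} (\<lambda>s. f (g s) * norm (vector_derivative g (at s within {0..1})))"

end

theory Submission
  imports Defs
begin

text \<open>
  The proof differentiates the shoelace formula, which expresses the area of the inside as half the
  sum of the determinants of consecutive vertices.

  The formula itself comes from winding numbers.  A polygon numbered counterclockwise has winding
  number \<open>1\<close> about the points of its inside and \<open>0\<close> about those of its outside, so its area is the
  integral of its winding number over the plane.  This winding number is the sum of those of the
  triangles formed by the origin and the edges, and the winding number of a triangle integrates
  to its signed area (\<open>has_integral_winding_number_triangle_origin\<close>, \<open>shoelace_formula\<close>).

  The normals enter through the fact that the inside lies on the left of every edge
  (\<open>edge_sides\<close>): the winding number jumps by \<open>1\<close> across an edge, as that of any positively
  oriented triangle on this edge does.  Hence the outward normal is the edge direction turned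
  clockwise (\<open>outward_normal_eq\<close>).  In an equivalence class the normals are constant in time, which
  forces both endpoints of an edge to have the same normal velocity (\<open>motion_velocities\<close>); so the
  normal velocity is constant along the edge, and its arc length integral is the sum of the edge
  lengths times the edge velocities (\<open>arclength_integral_polygon_path\<close>).  A summation by parts
  around the polygon identifies this sum with the derivative of the shoelace formula
  (\<open>shoelace_rate_eq_flux\<close>).
\<close>

section \<open>Triangles\<close>

text \<open>
  The determinant of the two vectors, that is, twice the signed area of the triangle \<open>0, a, b\<close>.
\<close>

definition cross2 :: "complex \<Rightarrow> complex \<Rightarrow> real" where
  "cross2 a b = Im (cnj a * b)"

lemma measurable_vec_to_complex [measurable]:
  "(\<lambda>v::real^2. Complex (v $ 1) (v $ 2)) \<in> borel_measurable borel"
proof (rule borel_measurable_continuous_onI)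
  show "continuous_on UNIV (\<lambda>v::real^2. Complex (v $ 1) (v $ 2))"
    by (auto simp: Complex_eq intro!: continuous_intros)
qed

text \<open>
  The area formula \<open>content_triangle\<close> concerns the coordinate space \<open>real^2\<close>.  The isometry below
  carries it over to the complex plane, because both Lebesgue measures give a box the product of
  its side lengths.
\<close>

lemma lborel_complex_eq_distr:
  "(lborel :: complex measure) = distr lborel borel (\<lambda>v::real^2. Complex (v $ 1) (v $ 2))"
proof (rule lborel_eqI)
  fix l u :: complex
  assume le: "\<And>b. b \<in> Basis \<Longrightarrow> l \<bullet> b \<le> u \<bullet> b"
  have le': "Re l \<le> Re u" "Im l \<le> Im u"
    using le[of 1] le[of \<i>] by (auto simp: Basis_complex_def)
  have pre: "(\<lambda>v::real^2. Complex (v $ 1) (v $ 2)) -` box l u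
      = box (vector [Re l, Im l]) (vector [Re u, Im u])"
    by (auto simp: box_def Basis_complex_def Basis_vec_def axis_def inner_axis forall_2 exhaust_2
        inner_vec_def sum_2)
  have B: "(Basis :: (real^2) set) = {axis 1 1, axis 2 1}"
    by (auto simp: Basis_vec_def) (metis exhaust_2)
  have ne: "axis 1 (1::real) \<noteq> (axis 2 1 :: real^2)"
    by (simp add: axis_eq_axis)
  show "emeasure (distr lborel borel (\<lambda>v::real^2. Complex (v $ 1) (v $ 2))) (box l u)
      = ennreal (\<Prod>b\<in>Basis. (u - l) \<bullet> b)"
    using le'
    by (subst emeasure_distr)
       (auto simp: measurable_vec_to_complex pre emeasure_lborel_box_eq B ne inner_axis Basis_complex_def)
qed simp

lemma measure_lborel_complex_vimage:
  assumes "closed S"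
  shows "measure lborel S = measure lborel {v::real^2. Complex (v $ 1) (v $ 2) \<in> S}"
  by (subst lborel_complex_eq_distr, subst measure_distr)
     (use assms measurable_vec_to_complex in \<open>auto simp: vimage_def\<close>)

lemma measure_triangle_complex:
  fixes a b :: complex
  shows "measure lebesgue (convex hull {0, a, b}) = \<bar>cross2 a b\<bar> / 2"
proof -
  define T where "T = (\<lambda>v::real^2. Complex (v $ 1) (v $ 2))"
  define A :: "real^2" where "A = vector [Re a, Im a]"
  define B :: "real^2" where "B = vector [Re b, Im b]"
  have lin: "linear T"
    by (rule linearI) (auto simp: T_def complex_eq_iff)
  have inj: "inj T"
    by (auto simp: T_def inj_on_def vec_eq_iff forall_2)
  have im: "T ` {0, A, B} = {0, a, b}"
    by (auto simp: T_def A_def B_def complex_eq_iff)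
  have hull: "convex hull {0, a, b} = T ` (convex hull {0, A, B})"
    using convex_hull_linear_image[OF lin, of "{0,A,B}"] im by simp
  have "{v. T v \<in> convex hull {0, a, b}} = convex hull {0, A, B}"
    unfolding hull using inj by (auto simp: inj_on_def)
  moreover have "closed (convex hull {0, a, b})"
    by (simp add: compact_convex_hull compact_imp_closed)
  ultimately have "measure lborel (convex hull {0, a, b}) = measure lborel (convex hull {0, A, B})"
    using measure_lborel_complex_vimage[of "convex hull {0, a, b}"] by (simp add: T_def)
  also have "\<dots> = \<bar>cross2 a b\<bar> / 2"
    by (subst content_triangle) (simp add: A_def B_def cross2_def abs_minus_commute algebra_simps)
  finally show ?thesis
    using \<open>closed _\<close> by (simp add: measure_completion)
qed

text \<open>
  An interior point has positive barycentric coordinates, and with respect to them the sign that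
  decides between winding numbers \<open>1\<close> and \<open>-1\<close> is the sign of \<open>cross2 a b\<close>.  For a degenerate triangle
  every point of the hull lies on its frontier.
\<close>

lemma winding_number_triangle_origin:
  fixes a b z :: complex
  assumes "z \<notin> frontier (convex hull {0, a, b})"
  shows "winding_number (linepath 0 a +++ linepath a b +++ linepath b 0) z
    = of_real (sgn (cross2 a b) * indicator (convex hull {0, a, b}) z)"
proof (cases "z \<in> convex hull {0, a, b}")
  case True
  then have int: "z \<in> interior (convex hull {0, a, b})"
    using assms by (auto simp: frontier_def closure_def)
  have "aff_dim {0, a, b} = 2"
    using int aff_dim_nonempty_interior[of "convex hull {0, a, b}"]
    by (auto simp: aff_dim_convex_hull)
  then have nc: "\<not> collinear {0, a, b}"
    by (simp add: collinear_aff_dim)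
  have hull: "interior (convex hull {0, a, b})
      = {v. \<exists>x y z. 0 < x \<and> 0 < y \<and> 0 < z \<and> x + y + z = 1 \<and> x *\<^sub>R 0 + y *\<^sub>R a + z *\<^sub>R b = v}"
    by (rule interior_convex_hull_3_minimal[OF nc]) simp
  obtain r s t where rst: "0 < r" "0 < s" "0 < t" "r + s + t = 1" "z = s *\<^sub>R a + t *\<^sub>R b"
    using int unfolding hull by auto
  from nc have "b / a \<notin> \<real>"
    by (simp add: collinear_iff_Reals)
  then have "cross2 a b \<noteq> 0"
    by (simp add: complex_is_Real_iff Im_complex_div_eq_0 cross2_def mult.commute)
  have Im: "Im (a * cnj (a - z)) = t * cross2 a b"
    by (simp add: rst cross2_def algebra_simps)
  with \<open>cross2 a b \<noteq> 0\<close> show ?thesis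
    using winding_number_triangle[OF int] True rst Im
    by (simp add: zero_less_mult_iff sgn_real_def)
next
  case False
  have "path_image (linepath 0 a +++ linepath a b +++ linepath b 0) \<subseteq> convex hull {0, a, b}"
    by (simp add: path_image_join segment_convex_hull hull_mono)
  then show ?thesis
    using False by (simp add: winding_number_zero_outside[of _ "convex hull {0,a,b}"])
qed


text \<open>
  The orientation sign of the winding number turns the unsigned area of the triangle into the
  signed one; this is what makes the contributions of the edges additive in the shoelace formula.
\<close>

lemma has_integral_winding_number_triangle_origin:
  fixes a b :: complex
  shows "((\<lambda>z. Re (winding_number (linepath 0 a +++ linepath a b +++ linepath b 0) z))
    has_integral cross2 a b / 2) UNIV"
proof -
  let ?K = "convex hull {0, a, b}"
  have "bounded ?K"
    by (simp add: bounded_convex_hull)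
  then have "?K \<in> lmeasurable"
    by (simp add: compact_convex_hull lmeasurable_compact)
  then have "(indicat_real ?K has_integral \<bar>cross2 a b\<bar> / 2) UNIV"
    using lmeasurable_iff_indicator_has_integral[of ?K] measure_triangle_complex[of a b] by metis
  then have *: "((\<lambda>z. sgn (cross2 a b) * indicat_real ?K z) has_integral
      sgn (cross2 a b) * (\<bar>cross2 a b\<bar> / 2)) UNIV"
    by (rule has_integral_mult_right)
  have "((\<lambda>z. Re (winding_number (linepath 0 a +++ linepath a b +++ linepath b 0) z))
      has_integral sgn (cross2 a b) * (\<bar>cross2 a b\<bar> / 2)) UNIV"
    by (rule has_integral_spike[OF _ _ *, of "frontier ?K"])
       (auto simp: negligible_convex_frontier winding_number_triangle_origin)
  then show ?thesis
    by (simp add: sgn_mult_abs)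
qed

section \<open>Polygons and their edges\<close>

text \<open>
  The edge with number \<open>k + 1\<close>, indexed by a natural number so that the polygon consists of the
  pieces \<open>k < N\<close>.
\<close>

definition edge_path :: "(int \<Rightarrow> complex) \<Rightarrow> nat \<Rightarrow> real \<Rightarrow> complex" where
  "edge_path w k = linepath (w (int k)) (w (int k + 1))"

text \<open>
  The parameter \<open>\<theta> = 1\<close> needs its own argument: there the floor in the definition of the path has
  already jumped to the next edge, which starts where this one ends.
\<close>

lemma polygon_path_edge:
  assumes "0 < N" "0 \<le> \<theta>" "\<theta> \<le> 1"
  shows "polygon_path N w ((real k + \<theta>) / real N) = edge_path w k \<theta>"
proof (cases "\<theta> = 1")
  case True
  have "real N * ((real k + \<theta>) / real N) = of_int (int k + 1)"
    using assms True by simp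
  then show ?thesis
    unfolding polygon_path_def edge_path_def linepath_def
    by (simp only: frac_of_int floor_of_int) (simp add: True)
next
  case False
  have eq: "real N * ((real k + \<theta>) / real N) = real k + \<theta>"
    using assms by simp
  have "\<lfloor>real k + \<theta>\<rfloor> = int k"
    using assms False by (simp add: floor_eq_iff)
  then show ?thesis
    unfolding polygon_path_def edge_path_def linepath_def eq by (simp add: frac_def)
qed

lemma simple_path_interior_injective:
  fixes p :: "real \<Rightarrow> 'a::topological_space"
  assumes "simple_path p" "p s = p u" "0 < s" "s < 1" "0 \<le> u" "u \<le> 1"
  shows "s = u"
proof -
  have "s \<in> {0..1}" "u \<in> {0..1}"
    using assms by auto
  with assms(1,2) have "s = u \<or> s = 0 \<and> u = 1 \<or> s = 1 \<and> u = 0"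
    unfolding simple_path_def loop_free_def by blast
  then show ?thesis
    using assms by auto
qed

lemma is_polygonD:
  assumes "is_polygon N w"
  shows is_polygon_pos: "0 < N"
    and is_polygon_periodic: "w (j + int N) = w j"
    and is_polygon_simple: "simple_path (polygon_path N w)"
    and is_polygon_closed: "pathfinish (polygon_path N w) = pathstart (polygon_path N w)"
    and is_polygon_consecutive: "w (j - 1) \<noteq> w j"
    and is_polygon_winding: "z \<in> inside (polygon_curve N w) \<Longrightarrow> winding_number (polygon_path N w) z = 1"
proof -
  show per: "w (j + int N) = w j" for j
    using assms by (simp add: is_polygon_def)
  show simple: "simple_path (polygon_path N w)"
    using assms by (simp add: is_polygon_def)
  show pos: "0 < N"
  proof (rule ccontr)
    assume "\<not> 0 < N"
    then have "polygon_path N w (1/2) = polygon_path N w (1/3)"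
      by (simp add: polygon_path_def)
    then show False
      using simple_path_interior_injective[OF simple, of "1/2" "1/3"] by simp
  qed
  have "polygon_path N w 1 = w (0 + int N)" "polygon_path N w 0 = w 0"
    by (simp_all add: polygon_path_def frac_def)
  then show "pathfinish (polygon_path N w) = pathstart (polygon_path N w)"
    by (simp only: per pathfinish_def pathstart_def)
  show "w (j - 1) \<noteq> w j"
  proof
    assume "w (j - 1) = w j"
    then have "collinear {w (j - 1), w j, w (j + 1)}" by simp
    then show False using assms by (simp add: is_polygon_def)
  qed
  show "winding_number (polygon_path N w) z = 1" if "z \<in> inside (polygon_curve N w)"
    using that assms by (simp add: is_polygon_def)
qed

lemma polygon_edge_eq_image:
  assumes "is_polygon N w"
  shows "polygon_edge w (int k + 1) = edge_path w k ` {0<..<1}"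
  using is_polygon_consecutive[OF assms, of "int k + 1"]
  by (auto simp: polygon_edge_def edge_path_def open_segment_image_interval linepath_def)

lemma unit_interval_piece:
  fixes s :: real
  assumes "0 < N" "s \<in> {0..1}"
  obtains k \<theta> where "k < N" "0 \<le> \<theta>" "\<theta> \<le> 1" "s = (real k + \<theta>) / real N"
proof (cases "s = 1")
  case True
  show ?thesis
    by (rule that[of "N - 1" 1]) (use assms True in \<open>auto simp: of_nat_diff\<close>)
next
  case False
  define k where "k = nat \<lfloor>real N * s\<rfloor>"
  have fl: "real k = of_int \<lfloor>real N * s\<rfloor>"
    using assms by (simp add: k_def)
  have "real N * s < real N"
    using assms False by simp
  then have "k < N"
    using fl of_int_floor_le[of "real N * s"] by linarith
  moreover have "0 \<le> real N * s - real k" "real N * s - real k \<le> 1"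
    using fl by linarith+
  ultimately show ?thesis
    by (intro that[of k "real N * s - real k"]) (use assms in auto)
qed

lemma polygon_curve_eq_edges:
  assumes "0 < N"
  shows "polygon_curve N w = (\<Union>k<N. path_image (edge_path w k))"
proof
  show "polygon_curve N w \<subseteq> (\<Union>k<N. path_image (edge_path w k))"
  proof
    fix z assume "z \<in> polygon_curve N w"
    then obtain s where s: "s \<in> {0..1}" "z = polygon_path N w s"
      by (auto simp: polygon_curve_def path_image_def)
    obtain k \<theta> where k: "k < N" "0 \<le> \<theta>" "\<theta> \<le> 1" "s = (real k + \<theta>) / real N"
      using unit_interval_piece[OF assms s(1)] .
    then have "z = edge_path w k \<theta>"
      using polygon_path_edge[OF assms k(2,3), of w k] s by simp
    then show "z \<in> (\<Union>k<N. path_image (edge_path w k))"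
      using k by (force simp: path_image_def)
  qed
next
  show "(\<Union>k<N. path_image (edge_path w k)) \<subseteq> polygon_curve N w"
  proof
    fix z assume "z \<in> (\<Union>k<N. path_image (edge_path w k))"
    then obtain k \<theta> where k: "k < N" "0 \<le> \<theta>" "\<theta> \<le> 1" "z = edge_path w k \<theta>"
      by (auto simp: path_image_def)
    have "real k + 1 \<le> real N"
      using k by linarith
    then have "(real k + \<theta>) / real N \<in> {0..1}"
      using k assms by (auto simp: divide_simps)
    then show "z \<in> polygon_curve N w"
      using polygon_path_edge[OF assms k(2,3), of w k] k
      by (metis polygon_curve_def path_image_def imageI)
  qed
qed

text \<open>
  Points of different edges have different path parameters, and a parameter strictly inside \<open>(0, 1)\<close>
  is not affected by the identification of the two ends of a simple closed path.
\<close>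

lemma open_edge_avoids_other_edges:
  assumes poly: "is_polygon N w" and k: "k < N" "0 < \<theta>" "\<theta> < 1" and m: "m < N" "m \<noteq> k"
  shows "edge_path w k \<theta> \<notin> path_image (edge_path w m)"
proof
  note pos = is_polygon_pos[OF poly]
  assume "edge_path w k \<theta> \<in> path_image (edge_path w m)"
  then obtain \<phi> where \<phi>: "0 \<le> \<phi>" "\<phi> \<le> 1" "edge_path w m \<phi> = edge_path w k \<theta>"
    by (auto simp: path_image_def)
  define s where "s = (real k + \<theta>) / real N"
  define u where "u = (real m + \<phi>) / real N"
  have "real k + 1 \<le> real N" "real m + 1 \<le> real N"
    using k m by linarith+
  then have s: "0 < s" "s < 1" and u: "0 \<le> u" "u \<le> 1"
    using k \<phi> pos by (auto simp: s_def u_def divide_simps)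
  have "polygon_path N w s = polygon_path N w u"
    using polygon_path_edge[OF pos, of \<theta> w k] polygon_path_edge[OF pos, of \<phi> w m] k \<phi>
    by (simp add: s_def u_def)
  then have "s = u"
    using simple_path_interior_injective[OF is_polygon_simple[OF poly]] s u by blast
  then have "real k + \<theta> = real m + \<phi>"
    using pos by (simp add: s_def u_def)
  moreover have "real k + 1 \<le> real m \<or> real m + 1 \<le> real k"
    using m by linarith
  ultimately show False
    using k \<phi> by linarith
qed

text \<open>
  The winding number of a path that is not closed is the integral of \<open>1 / (\<zeta> - z)\<close> divided by \<open>2\<pi>\<i>\<close>,
  hence is additive under concatenation.
\<close>

lemma winding_number_polygon_path:
  assumes poly: "is_polygon N w" and z: "z \<notin> polygon_curve N w"
  shows "winding_number (polygon_path N w) z = (\<Sum>k<N. winding_number (edge_path w k) z)"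
proof -
  let ?p = "polygon_path N w"
  note pos = is_polygon_pos[OF poly]
  have path: "path ?p"
    using is_polygon_simple[OF poly] by (simp add: simple_path_def)
  have z': "z \<notin> path_image ?p"
    using z by (simp add: polygon_curve_def)
  have piece: "winding_number (subpath (real k / real N) (real (Suc k) / real N) ?p) z
      = winding_number (edge_path w k) z" for k
  proof (rule winding_number_cong)
    fix t :: real assume "0 \<le> t" "t \<le> 1"
    moreover have "(real (Suc k) / real N - real k / real N) * t + real k / real N = (real k + t) / real N"
      using pos by (simp add: field_simps)
    ultimately show "subpath (real k / real N) (real (Suc k) / real N) ?p t = edge_path w k t"
      using polygon_path_edge[OF pos] by (simp add: subpath_def)
  qed
  have "winding_number (subpath 0 (real n / real N) ?p) z = (\<Sum>k<n. winding_number (edge_path w k) z)"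
    if "n \<le> N" for n
    using that
  proof (induction n)
    case 0
    have "?p 0 \<noteq> z"
      using z' by (auto simp: path_image_def)
    then show ?case by simp
  next
    case (Suc n)
    have "winding_number (subpath 0 (real n / real N) ?p) z
        + winding_number (subpath (real n / real N) (real (Suc n) / real N) ?p) z
        = winding_number (subpath 0 (real (Suc n) / real N) ?p) z"
      by (rule winding_number_subpath_combine[OF path z'])
         (use Suc.prems pos in \<open>auto simp: divide_simps\<close>)
    then show ?case
      using Suc piece[of n] by simp
  qed
  from this[of N] show ?thesis
    using pos by simp
qed

section \<open>Winding numbers and the area of a polygon\<close>

lemma path_edge_path [simp]: "path (edge_path w k)"
  by (simp add: edge_path_def)

lemma negligible_closed_segment_complex: "negligible (closed_segment a b :: complex set)"
  by (simp add: negligible_convex_interior interior_closed_segment_ge2)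

lemma polygon_winding_cases:
  assumes poly: "is_polygon N w" and z: "z \<notin> polygon_curve N w"
  obtains "z \<in> inside (polygon_curve N w)" "winding_number (polygon_path N w) z = 1"
    | "z \<in> outside (polygon_curve N w)" "winding_number (polygon_path N w) z = 0"
proof (cases "z \<in> inside (polygon_curve N w)")
  case True
  then show ?thesis
    using is_polygon_winding[OF poly] that by blast
next
  case False
  then have out: "z \<in> outside (polygon_curve N w)"
    using z inside_Un_outside[of "polygon_curve N w"] by blast
  then have "winding_number (polygon_path N w) z = 0"
    using winding_number_zero_in_outside[OF simple_path_imp_path[OF is_polygon_simple[OF poly]]
        is_polygon_closed[OF poly]]
    by (simp add: polygon_curve_def)
  with out show ?thesis
    using that by blast
qed

text \<open>
  Almost everywhere the indicator function of the inside is the winding number of the polygon.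
  Closing each edge up to a triangle with apex \<open>0\<close> changes the sum of the winding numbers of the edges
  only by the spokes from \<open>0\<close> to the vertices; every spoke is used once in each direction, so these
  cancel.  Integrating the winding numbers of the triangles gives their signed areas.
\<close>

theorem shoelace_formula:
  assumes poly: "is_polygon N w"
  shows "measure lebesgue (inside (polygon_curve N w))
    = (\<Sum>k<N. cross2 (w (int k)) (w (int k + 1))) / 2"
proof -
  let ?p = "polygon_path N w"
  let ?T = "\<lambda>k. linepath 0 (w (int k)) +++ linepath (w (int k)) (w (int k + 1)) +++ linepath (w (int k + 1)) 0"
  define S where "S = polygon_curve N w \<union> (\<Union>k\<le>N. closed_segment 0 (w (int k)))"
  note pos = is_polygon_pos[OF poly]
  have "negligible (polygon_curve N w)"
    unfolding polygon_curve_eq_edges[OF pos]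
    by (intro negligible_Union) (auto simp: edge_path_def negligible_closed_segment_complex)
  then have negS: "negligible S"
    unfolding S_def
    by (intro negligible_Un negligible_Union) (auto simp: negligible_closed_segment_complex)
  have tri: "Re (winding_number ?p z) = (\<Sum>k<N. Re (winding_number (?T k) z))" if z: "z \<notin> S" for z
  proof -
    have zc: "z \<notin> polygon_curve N w" using z by (simp add: S_def)
    (* the spoke from the origin to vertex k *)
    define f where "f = (\<lambda>k. winding_number (linepath 0 (w (int k))) z)"
    have "winding_number (?T k) z = winding_number (edge_path w k) z + (f k - f (Suc k))" if "k < N" for k
    proof -
      have 1: "z \<notin> closed_segment (w (int k)) (w (int k + 1))"
        using zc that unfolding polygon_curve_eq_edges[OF pos] by (auto simp: edge_path_def)
      have "Suc k \<le> N" "k \<le> N" using that by auto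
      then have 2: "z \<notin> closed_segment 0 (w (int k))" "z \<notin> closed_segment 0 (w (int (Suc k)))"
        using z unfolding S_def by blast+
      have 3: "z \<notin> closed_segment 0 (w (int k + 1))"
        using 2 by (simp add: add.commute)
      have "winding_number (linepath (w (int k + 1)) 0) z = - f (Suc k)"
        using winding_number_reversepath[of "linepath 0 (w (int k + 1))" z] 3
        by (simp add: f_def add.commute)
      then show ?thesis
        using 1 2 3
        by (simp add: winding_number_join path_image_join closed_segment_commute f_def edge_path_def)
    qed
    then have "(\<Sum>k<N. winding_number (?T k) z)
        = (\<Sum>k<N. winding_number (edge_path w k) z) + (\<Sum>k<N. f k - f (Suc k))"
      by (simp add: sum.distrib)
    also have "(\<Sum>k<N. f k - f (Suc k)) = f 0 - f N"
      by (rule sum_lessThan_telescope')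
    also have "f N = f 0"
      using is_polygon_periodic[OF poly, of 0] by (simp add: f_def)
    finally show ?thesis
      by (simp only: winding_number_polygon_path[OF poly zc] Re_sum[symmetric] diff_self add_0_right)
  qed
  have "((\<lambda>z. \<Sum>k<N. Re (winding_number (?T k) z))
      has_integral (\<Sum>k<N. cross2 (w (int k)) (w (int k + 1)) / 2)) UNIV"
    by (intro has_integral_sum has_integral_winding_number_triangle_origin) auto
  then have "(indicat_real (inside (polygon_curve N w)) has_integral
      (\<Sum>k<N. cross2 (w (int k)) (w (int k + 1)) / 2)) UNIV"
  proof (rule has_integral_spike[OF negS, rotated])
    fix z assume "z \<in> UNIV - S"
    then have z: "z \<notin> S" by simp
    then have zc: "z \<notin> polygon_curve N w" by (simp add: S_def)
    have "indicat_real (inside (polygon_curve N w)) z = Re (winding_number ?p z)"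
    proof (rule polygon_winding_cases[OF poly zc])
      assume "z \<in> outside (polygon_curve N w)" "winding_number ?p z = 0"
      moreover from this have "z \<notin> inside (polygon_curve N w)"
        using inside_Int_outside[of "polygon_curve N w"] by blast
      ultimately show ?thesis by simp
    qed simp
    then show "indicat_real (inside (polygon_curve N w)) z = (\<Sum>k<N. Re (winding_number (?T k) z))"
      using tri[OF z] by simp
  qed
  then have "measure lebesgue (inside (polygon_curve N w)) = (\<Sum>k<N. cross2 (w (int k)) (w (int k + 1)) / 2)"
    using lmeasurable_iff_indicator_has_integral by metis
  then show ?thesis
    by (simp add: sum_divide_distrib)
qed

section \<open>The inside lies on the left of every edge\<close>

text \<open>
  This lemma and the next one express that the winding number of a triangle erected on the left of
  the segment from \<open>a\<close> to \<open>b\<close> drops from \<open>1\<close> to \<open>0\<close> when that segment is crossed from left to right.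
  Here \<open>z\<close> has the barycentric coordinates \<open>1 - \<theta> - \<tau>, \<theta>, \<tau>\<close>.
\<close>

lemma winding_number_triangle_left:
  fixes a b :: complex and \<theta> \<tau> :: real
  assumes "a \<noteq> b" "0 < \<theta>" "0 < \<tau>" "\<theta> + \<tau> < 1"
  defines "c \<equiv> a + \<i> * (b - a)" and "z \<equiv> a + (of_real \<theta> + \<i> * of_real \<tau>) * (b - a)"
  shows "winding_number (linepath a b +++ linepath b c +++ linepath c a) z = 1"
proof -
  have "Im (\<i> * (b - a) / (b - a)) \<noteq> 0"
    using assms by simp
  then have "\<not> collinear {0, b - a, \<i> * (b - a)}"
    unfolding collinear_iff_Reals complex_is_Real_iff .
  then have "\<not> collinear {a, b, c}"
    using collinear_3[of b a c] by (simp add: c_def insert_commute)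
  then have hull: "interior (convex hull {a, b, c})
      = {v. \<exists>x y t. 0 < x \<and> 0 < y \<and> 0 < t \<and> x + y + t = 1 \<and> x *\<^sub>R a + y *\<^sub>R b + t *\<^sub>R c = v}"
    by (rule interior_convex_hull_3_minimal) simp
  have "(1 - \<theta> - \<tau>) *\<^sub>R a + \<theta> *\<^sub>R b + \<tau> *\<^sub>R c = z"
    by (simp add: c_def z_def scaleR_conv_of_real algebra_simps)
  then have int: "z \<in> interior (convex hull {a, b, c})"
    unfolding hull using assms(2-4)
    by (intro CollectI exI[of _ "1 - \<theta> - \<tau>"] exI[of _ \<theta>] exI[of _ \<tau>]) auto
  have "b - z = (of_real (1 - \<theta>) - \<i> * of_real \<tau>) * (b - a)"
    by (simp add: z_def algebra_simps)
  then have "(b - a) * cnj (b - z) = (of_real (1 - \<theta>) + \<i> * of_real \<tau>) * ((b - a) * cnj (b - a))"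
    by simp
  also have "\<dots> = (of_real (1 - \<theta>) + \<i> * of_real \<tau>) * of_real ((norm (b - a))\<^sup>2)"
    by (simp only: complex_norm_square)
  finally have "Im ((b - a) * cnj (b - z)) = \<tau> * (norm (b - a))\<^sup>2"
    by simp
  then show ?thesis
    using winding_number_triangle[OF int] assms by simp
qed

text \<open>
  The triangle lies in the half-plane on the left of the line through \<open>a\<close> and \<open>b\<close>, and \<open>z\<close> does not.
\<close>

lemma winding_number_triangle_right:
  fixes a b :: complex and \<theta> \<tau> :: real
  assumes "a \<noteq> b" "0 < \<tau>"
  defines "c \<equiv> a + \<i> * (b - a)" and "z \<equiv> a + (of_real \<theta> - \<i> * of_real \<tau>) * (b - a)"
  shows "winding_number (linepath a b +++ linepath b c +++ linepath c a) z = 0"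
proof -
  let ?H = "{v. (\<i> * (b - a)) \<bullet> v \<ge> (\<i> * (b - a)) \<bullet> a}"
  have inner: "(\<i> * (b - a)) \<bullet> (a + (of_real x + \<i> * of_real y) * (b - a))
      = (\<i> * (b - a)) \<bullet> a + y * (norm (b - a))\<^sup>2" for x y :: real
    unfolding cmod_power2 by (simp add: inner_complex_def power2_eq_square algebra_simps)
  have "a \<in> ?H" "b \<in> ?H" "c \<in> ?H"
    using inner[of 1 0] inner[of 0 1] by (auto simp: c_def)
  moreover have conv: "convex ?H"
    by (rule convex_halfspace_ge)
  ultimately have "path_image (linepath a b +++ linepath b c +++ linepath c a) \<subseteq> ?H"
    using closed_segment_subset[OF _ _ conv] by (simp add: path_image_join)
  moreover have "0 < \<tau> * (norm (b - a))\<^sup>2"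
    using assms(1,2) by simp
  then have "z \<notin> ?H"
    using inner[of \<theta> "- \<tau>"] by (simp add: z_def)
  ultimately show ?thesis
    using conv by (intro winding_number_zero_outside[of _ ?H]) simp_all
qed

text \<open>
  Near a point of the open edge, the winding number of the polygon and that of a triangle erected on
  this edge differ by a function \<open>f\<close> that collects only edges away from the point and is therefore
  continuous there.  So the winding number of the polygon jumps across the edge exactly as that of
  the triangle does: it is larger by \<open>1\<close> on the left.  As it takes only the values \<open>1\<close> on the inside and
  \<open>0\<close> on the outside, the left is inside and the right is outside.
\<close>

lemma edge_sides:
  assumes poly: "is_polygon N w" and k: "k < N" and \<theta>: "0 < \<theta>" "\<theta> < 1"
  defines "x \<equiv> edge_path w k \<theta>" and "d \<equiv> w (int k + 1) - w (int k)"
  shows "\<forall>\<^sub>F s in at_right 0. x - s *\<^sub>R (\<i> * sgn d) \<in> outside (polygon_curve N w)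
           \<and> x + s *\<^sub>R (\<i> * sgn d) \<in> inside (polygon_curve N w)"
proof -
  let ?p = "polygon_path N w"
  note pos = is_polygon_pos[OF poly]
  define a where "a = w (int k)"
  define b where "b = w (int k + 1)"
  define c where "c = a + \<i> * (b - a)"
  have ab: "a \<noteq> b"
    using is_polygon_consecutive[OF poly, of "int k + 1"] by (simp add: a_def b_def)
  have d: "d = b - a" "d \<noteq> 0" using ab by (auto simp: d_def a_def b_def)
  have x: "x = a + of_real \<theta> * (b - a)"
    by (simp add: x_def edge_path_def linepath_def a_def b_def scaleR_conv_of_real algebra_simps)
  define l where "l = (\<lambda>s. x + s *\<^sub>R (\<i> * sgn d))"
  define r where "r = (\<lambda>s. x - s *\<^sub>R (\<i> * sgn d))"
  have lim: "(l \<longlongrightarrow> x) (at_right 0)" "(r \<longlongrightarrow> x) (at_right 0)"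
    unfolding l_def r_def by (auto intro!: tendsto_eq_intros)
  have l_eq: "l s = a + (of_real \<theta> + \<i> * of_real (s / norm d)) * (b - a)"
    and r_eq: "r s = a + (of_real \<theta> - \<i> * of_real (s / norm d)) * (b - a)" for s
    by (simp_all add: l_def r_def x d sgn_div_norm scaleR_conv_of_real field_simps)
  have off_line: "a + (of_real \<theta> + \<i> * of_real \<tau>) * (b - a) \<notin> closed_segment a b" if "\<tau> \<noteq> 0" for \<tau>
  proof
    assume "a + (of_real \<theta> + \<i> * of_real \<tau>) * (b - a) \<in> closed_segment a b"
    then obtain u where "a + (of_real \<theta> + \<i> * of_real \<tau>) * (b - a) = (1 - u) *\<^sub>R a + u *\<^sub>R b"
      by (auto simp: closed_segment_def)
    then have "(of_real \<theta> + \<i> * of_real \<tau>) * (b - a) = of_real u * (b - a)"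
      by (simp add: scaleR_conv_of_real algebra_simps)
    then have "of_real \<theta> + \<i> * of_real \<tau> = (of_real u :: complex)"
      using ab by simp
    then show False
      using that by (simp add: complex_eq_iff)
  qed
  have x_other: "x \<notin> path_image (edge_path w m)" if "m < N" "m \<noteq> k" for m
    using open_edge_avoids_other_edges[OF poly k \<theta>] that by (simp add: x_def)
  have x_bc: "x \<notin> closed_segment b c" "x \<notin> closed_segment c a"
  proof -
    show "x \<notin> closed_segment b c"
    proof
      assume "x \<in> closed_segment b c"
      then obtain u where "x = (1 - u) *\<^sub>R b + u *\<^sub>R c"
        by (auto simp: closed_segment_def)
      then have "of_real \<theta> * (b - a) = (of_real (1 - u) + \<i> * of_real u) * (b - a)"
        by (simp add: x c_def scaleR_conv_of_real algebra_simps)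
      then have "of_real \<theta> = of_real (1 - u) + \<i> * (of_real u :: complex)"
        using ab by simp
      then show False
        using \<theta> by (simp add: complex_eq_iff)
    qed
    show "x \<notin> closed_segment c a"
    proof
      assume "x \<in> closed_segment c a"
      then obtain u where "x = (1 - u) *\<^sub>R c + u *\<^sub>R a"
        by (auto simp: closed_segment_def)
      then have "of_real \<theta> * (b - a) = (\<i> * of_real (1 - u)) * (b - a)"
        by (simp add: x c_def scaleR_conv_of_real algebra_simps)
      then have "of_real \<theta> = \<i> * (of_real (1 - u) :: complex)"
        using ab by (metis mult_cancel_right right_minus_eq)
      then show False
        using \<theta> by (simp add: complex_eq_iff)
    qed
  qed
  (* all segments other than the given edge that occur in the polygon or in the triangle *)
  define K where "K = (\<Union>m\<in>{..<N} - {k}. path_image (edge_path w m)) \<union> closed_segment b c \<union> closed_segment c a"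
  have "closed K"
    unfolding K_def by (intro closed_Un closed_UN) (auto simp: edge_path_def)
  then have openK: "open (- K)" by (simp add: open_closed)
  have "x \<in> - K"
    using x_other x_bc by (auto simp: K_def)
  then have offK: "\<forall>\<^sub>F s in at_right 0. l s \<in> - K" "\<forall>\<^sub>F s in at_right 0. r s \<in> - K"
    using topological_tendstoD[OF lim(1) openK] topological_tendstoD[OF lim(2) openK] by auto
  define f where "f = (\<lambda>z. (\<Sum>m\<in>{..<N} - {k}. winding_number (edge_path w m) z)
      - winding_number (linepath b c) z - winding_number (linepath c a) z)"
  have "isCont f x"
    unfolding f_def
    by (intro continuous_diff continuous_sum continuous_at_winding_number)
       (use x_other x_bc in auto)
  then have "((\<lambda>s. f (l s) - f (r s)) \<longlongrightarrow> f x - f x) (at_right 0)"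
    by (intro tendsto_diff isCont_tendsto_compose[of x f] lim)
  then have "\<forall>\<^sub>F s in at_right 0. norm (f (l s) - f (r s)) < 1"
    using order_tendstoD(2)[OF tendsto_norm, of _ 0 _ 1] by fastforce
  (* so close to the edge that the points on the left lie in the triangle *)
  moreover have "\<forall>\<^sub>F s in at_right 0. 0 < s \<and> s < (1 - \<theta>) * norm d"
    using \<theta> d
    by (intro eventually_at_rightI[of 0 "(1 - \<theta>) * norm d"]) auto
  ultimately have "\<forall>\<^sub>F s in at_right 0. r s \<in> outside (polygon_curve N w) \<and> l s \<in> inside (polygon_curve N w)"
    using offK
  proof eventually_elim
    case (elim s)
    let ?T = "linepath a b +++ linepath b c +++ linepath c a"
    define \<tau> where "\<tau> = s / norm d"
    have \<tau>: "0 < \<tau>" "\<theta> + \<tau> < 1"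
      using elim d by (auto simp: \<tau>_def field_simps)
    have Tl: "winding_number ?T (l s) = 1"
      unfolding l_eq c_def \<tau>_def[symmetric] by (rule winding_number_triangle_left) (use ab \<theta> \<tau> in auto)
    have Tr: "winding_number ?T (r s) = 0"
      unfolding r_eq c_def \<tau>_def[symmetric] by (rule winding_number_triangle_right) (use ab \<tau> in auto)
    have seg: "l s \<notin> closed_segment a b" "r s \<notin> closed_segment a b"
      using off_line[of \<tau>] off_line[of "- \<tau>"] \<tau> by (simp_all add: l_eq r_eq flip: \<tau>_def)
    have wn: "z \<notin> polygon_curve N w \<and> winding_number ?p z = f z + winding_number ?T z"
      if z: "z \<notin> closed_segment a b" "z \<in> - K" for z
    proof -
      have zc: "z \<notin> polygon_curve N w"
        using z unfolding polygon_curve_eq_edges[OF pos] K_def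
        by (auto simp: edge_path_def a_def b_def)
      have "winding_number ?p z = winding_number (edge_path w k) z
          + (\<Sum>m\<in>{..<N} - {k}. winding_number (edge_path w m) z)"
        unfolding winding_number_polygon_path[OF poly zc] using k by (simp add: sum.remove)
      moreover have "winding_number ?T z = winding_number (linepath a b) z
          + winding_number (linepath b c) z + winding_number (linepath c a) z"
        using z by (simp add: winding_number_join path_image_join K_def)
      ultimately show ?thesis
        using zc by (simp add: f_def edge_path_def a_def b_def)
    qed
    have wnl: "l s \<notin> polygon_curve N w" "winding_number ?p (l s) = f (l s) + 1"
      and wnr: "r s \<notin> polygon_curve N w" "winding_number ?p (r s) = f (r s)"
      using wn[of "l s"] wn[of "r s"] seg elim Tl Tr by auto
    have "norm (winding_number ?p (l s) - winding_number ?p (r s) - 1) < 1"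
      using elim wnl wnr by simp
    then show ?case
      by (cases rule: polygon_winding_cases[OF poly wnl(1)]; cases rule: polygon_winding_cases[OF poly wnr(1)]) simp_all
  qed
  then show ?thesis
    by (simp add: l_def r_def)
qed

text \<open>
  The definite description defining the normal is satisfied by exactly one of the two unit vectors
  orthogonal to the edge, because the other one points to the inside.
\<close>

lemma outward_normal_eq:
  assumes poly: "is_polygon N w" and k: "k < N"
  shows "outward_normal N w (int k + 1) = - \<i> * sgn (w (int k + 1) - w (int k))"
proof -
  define d where "d = w (int k + 1) - w (int k)"
  have d: "d \<noteq> 0"
    using is_polygon_consecutive[OF poly, of "int k + 1"] by (simp add: d_def)
  note edge = polygon_edge_eq_image[OF poly, of k]
  note sides = edge_sides[OF poly k, folded d_def]
  have "outward_normal N w (int k + 1) = - \<i> * sgn d"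
    unfolding outward_normal_def
  proof (rule the_equality, intro conjI ballI)
    show "norm (- \<i> * sgn d) = 1"
      using d by (simp add: norm_mult norm_sgn)
    have "(- \<i> * sgn d) \<bullet> d = 0"
      by (simp add: sgn_div_norm inner_complex_def)
    then show "(- \<i> * sgn d) \<bullet> (w (int k + 1) - w (int k + 1 - 1)) = 0"
      by (simp add: d_def)
    fix x assume "x \<in> polygon_edge w (int k + 1)"
    then obtain \<theta> where "0 < \<theta>" "\<theta> < 1" "x = edge_path w k \<theta>"
      unfolding edge by auto
    then show "\<forall>\<^sub>F s in at_right 0. x + s *\<^sub>R (- \<i> * sgn d) \<in> outside (polygon_curve N w)"
      using sides[of \<theta>] by (simp add: eventually_conj_iff)
  next
    fix n assume n: "norm n = 1 \<and> n \<bullet> (w (int k + 1) - w (int k + 1 - 1)) = 0 \<and>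
      (\<forall>x\<in>polygon_edge w (int k + 1). \<forall>\<^sub>F s in at_right 0. x + s *\<^sub>R n \<in> outside (polygon_curve N w))"
    (* in the frame of the edge, n is the number q, which has to be one of the two imaginary units *)
    define q where "q = n / sgn d"
    have nq: "n = q * sgn d" using d by (simp add: q_def sgn_zero_iff)
    have "norm q = 1"
      using n d by (simp add: q_def norm_divide norm_sgn)
    have "n \<bullet> d = Re q * norm d"
    proof -
      have "n \<bullet> d = Re (q * (sgn d * cnj d))"
        by (simp add: nq inner_complex_def algebra_simps)
      also have "sgn d * cnj d = of_real (norm d)"
        using d complex_norm_square[of d]
        by (simp add: sgn_div_norm scaleR_conv_of_real field_simps power2_eq_square)
      finally show ?thesis by simp
    qed
    then have "Re q = 0"
      using n d by (simp flip: d_def)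
    then have "\<bar>Im q\<bar> = 1"
      using \<open>norm q = 1\<close> by (simp add: cmod_def)
    then have "q = \<i> \<or> q = - \<i>"
      using \<open>Re q = 0\<close> by (auto simp: complex_eq_iff abs_if split: if_splits)
    moreover have "q \<noteq> \<i>"
    proof
      assume "q = \<i>"
      let ?x = "edge_path w k (1/2)"
      have "?x \<in> polygon_edge w (int k + 1)" unfolding edge by auto
      then have "\<forall>\<^sub>F s in at_right 0. ?x + s *\<^sub>R (\<i> * sgn d) \<in> outside (polygon_curve N w)"
        using n nq \<open>q = \<i>\<close> by auto
      moreover have "\<forall>\<^sub>F s in at_right 0. ?x + s *\<^sub>R (\<i> * sgn d) \<in> inside (polygon_curve N w)"
        using sides[of "1/2"] by (simp add: eventually_conj_iff)
      ultimately have "\<forall>\<^sub>F s in at_right (0::real). False"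
        by eventually_elim (use inside_Int_outside[of "polygon_curve N w"] in blast)
      then show False by simp
    qed
    ultimately show "n = - \<i> * sgn d"
      using nq by auto
  qed
  then show ?thesis by (simp add: d_def)
qed

section \<open>Integration along the polygon\<close>

lemma edge_length_edge: "edge_length w (int k + 1) = norm (w (int k + 1) - w (int k))"
  by (simp add: edge_length_def dist_norm norm_minus_commute)

lemma sum_edges: "(\<Sum>j = 1..int N. F j) = (\<Sum>k<N. F (int k + 1))"
  by (rule sum.reindex_bij_witness[of _ "\<lambda>k. int k + 1" "\<lambda>j. nat (j - 1)"]) auto

lemma vector_derivative_polygon_path:
  assumes "0 < N" "real k / real N < s" "s < real (Suc k) / real N" "k < N"
  shows "vector_derivative (polygon_path N w) (at s within {0..1})
    = real N *\<^sub>R (w (int k + 1) - w (int k))"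
proof -
  let ?g = "\<lambda>u. edge_path w k (real N * u - real k)"
  have "(edge_path w k has_vector_derivative (w (int k + 1) - w (int k))) (at (real N * s - real k))"
    unfolding edge_path_def by (rule has_vector_derivative_linepath_within)
  moreover have "((\<lambda>u. real N * u - real k) has_real_derivative real N) (at s)"
    by (auto intro!: derivative_eq_intros)
  ultimately have "(?g has_vector_derivative real N *\<^sub>R (w (int k + 1) - w (int k))) (at s)"
    using vector_diff_chain_at[of "\<lambda>u. real N * u - real k" "real N" s "edge_path w k"]
    by (simp add: o_def has_real_derivative_iff_has_vector_derivative)
  then have "(polygon_path N w has_vector_derivative real N *\<^sub>R (w (int k + 1) - w (int k))) (at s)"
  proof (rule has_vector_derivative_transform_within_open)
    show "s \<in> {real k / real N<..<real (Suc k) / real N}" using assms by simp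
    fix u assume "u \<in> {real k / real N<..<real (Suc k) / real N}"
    then have "0 \<le> real N * u - real k" "real N * u - real k \<le> 1"
      using assms(1) by (auto simp: field_simps)
    from polygon_path_edge[OF assms(1) this, of w k]
    show "?g u = polygon_path N w u"
      using assms(1) by simp
  qed simp
  moreover have "real (Suc k) / real N \<le> 1" "0 \<le> real k / real N"
    using assms(1,4) by auto
  then have "0 \<le> s" "s \<le> 1"
    using assms(2,3) by linarith+
  ultimately show ?thesis
    by (intro vector_derivative_at_within_ivl) auto
qed

text \<open>
  Edge \<open>k\<close> is traversed with speed \<open>N\<close> times its length during a time \<open>1 / N\<close>; the endpoints of these
  time intervals do not contribute.
\<close>

lemma arclength_integral_polygon_path:
  assumes poly: "is_polygon N w"
    and f: "\<And>k \<theta>. k < N \<Longrightarrow> 0 < \<theta> \<Longrightarrow> \<theta> < 1 \<Longrightarrow> f (edge_path w k \<theta>) = v k"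
  shows "arclength_integral (polygon_path N w) f = (\<Sum>k<N. edge_length w (int k + 1) * v k)"
proof -
  note pos = is_polygon_pos[OF poly]
  let ?h = "\<lambda>s. f (polygon_path N w s) * norm (vector_derivative (polygon_path N w) (at s within {0..1}))"
  have piece: "(?h has_integral edge_length w (int k + 1) * v k) {real k / real N..real (Suc k) / real N}"
    if k: "k < N" for k
  proof -
    let ?c = "v k * (real N * edge_length w (int k + 1))"
    have "((\<lambda>s. ?c) has_integral (real (Suc k) / real N - real k / real N) *\<^sub>R ?c)
        {real k / real N..real (Suc k) / real N}"
      using has_integral_const_real[of ?c "real k / real N" "real (Suc k) / real N"] pos
      by (simp add: content_real divide_right_mono)
    moreover have "(real (Suc k) / real N - real k / real N) *\<^sub>R ?c = edge_length w (int k + 1) * v k"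
      using pos by (simp add: field_simps)
    ultimately have "((\<lambda>s. ?c) has_integral edge_length w (int k + 1) * v k)
        {real k / real N..real (Suc k) / real N}"
      by (simp only:)
    then show ?thesis
    proof (rule has_integral_spike_finite[of "{real k / real N, real (Suc k) / real N}", rotated 2])
      fix s assume "s \<in> {real k / real N..real (Suc k) / real N} - {real k / real N, real (Suc k) / real N}"
      then have s: "real k / real N < s" "s < real (Suc k) / real N" by auto
      define \<theta> where "\<theta> = real N * s - real k"
      have \<theta>: "0 < \<theta>" "\<theta> < 1" using s pos by (auto simp: \<theta>_def field_simps)
      have "polygon_path N w s = edge_path w k \<theta>"
        using polygon_path_edge[of N \<theta> w k] \<theta> pos by (simp add: \<theta>_def)
      then show "?h s = ?c"
        using f[OF k \<theta>] vector_derivative_polygon_path[OF pos s k, of w]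
        by (simp add: edge_length_edge)
    qed simp
  qed
  have "(?h has_integral (\<Sum>k<n. edge_length w (int k + 1) * v k)) {0..real n / real N}" if "n \<le> N" for n
    using that
  proof (induction n)
    case 0
    then show ?case by (simp add: has_integral_refl)
  next
    case (Suc n)
    then show ?case
      using has_integral_combine[OF _ _ Suc.IH piece[of n]] pos
      by (simp add: divide_right_mono)
  qed
  from this[of N] pos show ?thesis
    unfolding arclength_integral_def by (simp add: integral_unique)
qed

lemma edge_param_edge_path:
  assumes "w (int k) \<noteq> w (int k + 1)"
  shows "edge_param w (int k + 1) (edge_path w k \<theta>) = \<theta>"
  unfolding edge_param_def
proof (rule the_equality)
  show "edge_path w k \<theta> = (1 - \<theta>) *\<^sub>R w (int k + 1 - 1) + \<theta> *\<^sub>R w (int k + 1)"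
    by (simp add: edge_path_def linepath_def)
  fix \<phi> assume "edge_path w k \<theta> = (1 - \<phi>) *\<^sub>R w (int k + 1 - 1) + \<phi> *\<^sub>R w (int k + 1)"
  then have "(\<phi> - \<theta>) *\<^sub>R (w (int k + 1) - w (int k)) = 0"
    by (simp add: edge_path_def linepath_def algebra_simps)
  then show "\<phi> = \<theta>" using assms by simp
qed

section \<open>The motion of a polygon within its class\<close>

text \<open>
  At an isolated point of its domain a function has every vector as derivative, so the choice in
  \<open>vector_derivative\<close> does not depend on the function.  This makes all vertices of a motion over a
  one-point interval have the same velocity, so that its edges still move by translation.
\<close>

lemma vector_derivative_bot: "vector_derivative f bot = vector_derivative g bot"
  by (simp add: vector_derivative_def has_vector_derivative_def has_derivative_def bounded_linear_scaleR_left)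

text \<open>
  The left-hand side is the derivative of the shoelace formula when the vertices \<open>w j\<close> have velocities
  \<open>u j\<close>.  The flux through an edge \<open>d\<close> is \<open>cross2 (u j) d\<close> for the velocity at either endpoint; taking
  the mean of the two and expanding gives the derivative up to the terms \<open>cross2 (u j) (w j)\<close>, which
  telescope around the polygon.
\<close>

lemma shoelace_rate_eq_flux:
  fixes w u :: "int \<Rightarrow> complex" and V :: "nat \<Rightarrow> real"
  assumes per: "w (int N) = w 0" "u (int N) = u 0"
    and V: "\<And>k. k < N \<Longrightarrow> u (int k) \<bullet> (- \<i> * sgn (w (int k + 1) - w (int k))) = V k"
      "\<And>k. k < N \<Longrightarrow> u (int k + 1) \<bullet> (- \<i> * sgn (w (int k + 1) - w (int k))) = V k"
  shows "(\<Sum>k<N. cross2 (u (int k)) (w (int k + 1)) + cross2 (w (int k)) (u (int k + 1))) / 2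
    = (\<Sum>k<N. edge_length w (int k + 1) * V k)"
proof -
  define g where "g = (\<lambda>k. cross2 (u (int k)) (w (int k)))"
  have flux: "norm d * (x \<bullet> (- \<i> * sgn d)) = cross2 x d" for x d :: complex
    by (cases "d = 0") (simp_all add: cross2_def inner_complex_def sgn_div_norm field_simps)
  have "cross2 (u (int k)) (w (int k + 1)) + cross2 (w (int k)) (u (int k + 1))
      = 2 * (edge_length w (int k + 1) * V k) + (g k - g (Suc k))" if "k < N" for k
  proof -
    let ?d = "w (int k + 1) - w (int k)"
    have "2 * (edge_length w (int k + 1) * V k) = cross2 (u (int k)) ?d + cross2 (u (int k + 1)) ?d"
      unfolding flux[symmetric] V[OF that] edge_length_edge by simp
    then show ?thesis
      by (simp add: g_def cross2_def algebra_simps)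
  qed
  then have "(\<Sum>k<N. cross2 (u (int k)) (w (int k + 1)) + cross2 (w (int k)) (u (int k + 1)))
      = 2 * (\<Sum>k<N. edge_length w (int k + 1) * V k) + (\<Sum>k<N. g k - g (Suc k))"
    by (simp add: sum.distrib sum_distrib_left)
  also have "(\<Sum>k<N. g k - g (Suc k)) = 0"
    unfolding sum_lessThan_telescope' using per by (simp add: g_def)
  finally show ?thesis by simp
qed

lemma has_real_derivative_cross2:
  assumes "(f has_vector_derivative f') (at t within I)" "(g has_vector_derivative g') (at t within I)"
  shows "((\<lambda>s. cross2 (f s) (g s)) has_real_derivative cross2 f' (g t) + cross2 (f t) g') (at t within I)"
proof -
  have Re_f: "((\<lambda>s. Re (f s)) has_real_derivative Re f') (at t within I)"
    and Im_f: "((\<lambda>s. Im (f s)) has_real_derivative Im f') (at t within I)"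
    and Re_g: "((\<lambda>s. Re (g s)) has_real_derivative Re g') (at t within I)"
    and Im_g: "((\<lambda>s. Im (g s)) has_real_derivative Im g') (at t within I)"
    unfolding has_real_derivative_iff_has_vector_derivative
    by (fact assms[THEN bounded_linear.has_vector_derivative[OF bounded_linear_Re]]
        assms[THEN bounded_linear.has_vector_derivative[OF bounded_linear_Im]])+
  have cross2_eq: "cross2 a b = Re a * Im b - Im a * Re b" for a b
    by (simp add: cross2_def)
  show ?thesis
    unfolding cross2_eq
    by (rule DERIV_cong[OF DERIV_diff[OF DERIV_mult[OF Re_f Im_g] DERIV_mult[OF Im_f Re_g]]])
       (simp add: algebra_simps)
qed

lemma inner_rotated_sgn: "d \<bullet> (- \<i> * sgn d) = 0" for d :: complex
  by (simp add: inner_complex_def sgn_div_norm)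

text \<open>
  The third part is the reason why the normal velocity is constant along each edge: the edge vector
  stays orthogonal to a normal that does not change in time, hence so does its derivative, which is
  the difference of the velocities of its endpoints.
\<close>

lemma motion_velocities:
  assumes motion: "C1_polygonal_motion I (polygon_class N w0) w" and t: "t \<in> I"
    and u: "\<And>j. u j = vertex_velocity I w j t"
  shows "((\<lambda>s. w s j) has_vector_derivative u j) (at t within I)"
    and "u (int N) = u 0"
    and "k < N \<Longrightarrow> u (int k + 1) \<bullet> outward_normal N w0 (int k + 1) = u (int k) \<bullet> outward_normal N w0 (int k + 1)"
proof -
  have poly: "is_polygon N (w s)" and normal: "outward_normal N (w s) i = outward_normal N w0 i"
    if "s \<in> I" for s i
    using motion that by (auto simp: C1_polygonal_motion_def polygon_class_def)
  show deriv: "((\<lambda>s. w s j) has_vector_derivative u j) (at t within I)" for j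
    using motion t unfolding C1_polygonal_motion_def u vertex_velocity_def
    by (meson differentiableI_vector vector_derivative_works)
  show "u (int N) = u 0"
  proof (cases "at t within I = bot")
    case True
    then show ?thesis by (simp add: u vertex_velocity_def vector_derivative_bot[of "\<lambda>s. w s (int N)" "\<lambda>s. w s 0"])
  next
    case False
    have "((\<lambda>s. w s 0) has_vector_derivative u (int N)) (at t within I)"
    proof (rule has_vector_derivative_transform[OF t _ deriv])
      show "w s 0 = w s (int N)" if "s \<in> I" for s
        using is_polygon_periodic[OF poly[OF that], of 0] by simp
    qed
    then show ?thesis
      using vector_derivative_unique_within[OF False _ deriv[of 0]] by simp
  qed
  assume k: "k < N"
  let ?n = "outward_normal N w0 (int k + 1)"
  show "u (int k + 1) \<bullet> ?n = u (int k) \<bullet> ?n"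
  proof (cases "at t within I = bot")
    case True
    then show ?thesis
      by (simp add: u vertex_velocity_def vector_derivative_bot[of "\<lambda>s. w s (int k + 1)" "\<lambda>s. w s (int k)"])
  next
    case False
    have "((\<lambda>s. (w s (int k + 1) - w s (int k)) \<bullet> ?n) has_vector_derivative
        (u (int k + 1) - u (int k)) \<bullet> ?n) (at t within I)"
      by (intro bounded_linear.has_vector_derivative[OF bounded_linear_inner_left]
          has_vector_derivative_diff deriv)
    moreover have "0 = (w s (int k + 1) - w s (int k)) \<bullet> ?n" if "s \<in> I" for s
      unfolding normal[OF that, symmetric] outward_normal_eq[OF poly[OF that] k]
      by (rule inner_rotated_sgn[symmetric])
    ultimately have "((\<lambda>s. 0) has_vector_derivative (u (int k + 1) - u (int k)) \<bullet> ?n) (at t within I)"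
      by (rule has_vector_derivative_transform[OF t, rotated])
    then have "(u (int k + 1) - u (int k)) \<bullet> ?n = 0"
      using vector_derivative_unique_within[OF False] has_vector_derivative_const by blast
    then show ?thesis by (simp add: inner_diff_left)
  qed
qed

section \<open>The rate of change of the area\<close>

theorem proposition2p2:
  fixes N :: nat and w0 :: "int \<Rightarrow> complex" and I :: "real set"
    and w :: "real \<Rightarrow> int \<Rightarrow> complex" and t :: real
  assumes "is_polygon N w0"
    and "is_interval I"
    and "C1_polygonal_motion I (polygon_class N w0) w"
    and "t \<in> I"
  shows "((\<lambda>s. measure lebesgue (inside (polygon_curve N (w s)))) has_real_derivative
            arclength_integral (polygon_path N (w t)) (normal_velocity N I w t)) (at t within I) \<and>
         arclength_integral (polygon_path N (w t)) (normal_velocity N I w t) =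
           (\<Sum>j = 1..int N. edge_length (w t) j * edge_velocity N I w j t)"
proof -
  note motion = assms(3) and t = assms(4)
  have poly: "is_polygon N (w s)" and normal: "outward_normal N (w s) i = outward_normal N w0 i"
    if "s \<in> I" for s i
    using motion that by (auto simp: C1_polygonal_motion_def polygon_class_def)
  define u where "u = (\<lambda>j. vertex_velocity I w j t)"
  have u: "u j = vertex_velocity I w j t" for j by (simp add: u_def)
  note velocities = motion_velocities[OF motion t, of u, OF u]
  define V where "V = (\<lambda>k. u (int k) \<bullet> outward_normal N w0 (int k + 1))"
  have at: "edge_velocity_at N I w (int k + 1) t (edge_path (w t) k \<theta>) = V k" if k: "k < N" for k \<theta>
  proof -
    have "w t (int k) \<noteq> w t (int k + 1)"
      using is_polygon_consecutive[OF poly[OF t], of "int k + 1"] by simp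
    from edge_param_edge_path[of "w t", OF this] show ?thesis
      using velocities(3)[OF k]
      by (simp add: edge_velocity_at_def Let_def normal[OF t] V_def u_def algebra_simps)
  qed
  have edge: "edge_velocity N I w (int k + 1) t = V k" if k: "k < N" for k
    unfolding edge_velocity_def polygon_edge_eq_image[OF poly[OF t]]
  proof (rule the_equality)
    show "\<forall>x\<in>edge_path (w t) k ` {0<..<1}. edge_velocity_at N I w (int k + 1) t x = V k"
      using at[OF k] by auto
    fix v assume v: "\<forall>x\<in>edge_path (w t) k ` {0<..<1}. edge_velocity_at N I w (int k + 1) t x = v"
    have "edge_path (w t) k (1/2) \<in> edge_path (w t) k ` {0<..<1}"
      by (intro imageI) simp
    with v show "v = V k"
      using at[OF k] by metis
  qed
  have nv: "normal_velocity N I w t (edge_path (w t) k \<theta>) = V k" if k: "k < N" "0 < \<theta>" "\<theta> < 1" for k \<theta>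
  proof -
    let ?x = "edge_path (w t) k \<theta>"
    have "edge_velocity_at N I w (int m + 1) t ?x * indicator (polygon_edge (w t) (int m + 1)) ?x
        = (if m = k then V k else 0)" if "m < N" for m
    proof (cases "m = k")
      case True
      then show ?thesis
        using k at[of k \<theta>] by (simp add: polygon_edge_eq_image[OF poly[OF t]])
    next
      case False
      then have "?x \<notin> path_image (edge_path (w t) m)"
        using open_edge_avoids_other_edges[OF poly[OF t] k that] by simp
      moreover have "polygon_edge (w t) (int m + 1) \<subseteq> path_image (edge_path (w t) m)"
        unfolding polygon_edge_eq_image[OF poly[OF t]] path_image_def by (intro image_mono) auto
      ultimately have "?x \<notin> polygon_edge (w t) (int m + 1)"
        by blast
      then show ?thesis
        using False by simp
    qed
    then have "normal_velocity N I w t ?x = (\<Sum>m<N. if m = k then V k else 0)"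
      unfolding normal_velocity_def sum_edges by (intro sum.cong) auto
    then show ?thesis using k by simp
  qed
  have flux: "arclength_integral (polygon_path N (w t)) (normal_velocity N I w t)
      = (\<Sum>k<N. edge_length (w t) (int k + 1) * V k)"
    by (rule arclength_integral_polygon_path[where v = V, OF poly[OF t]]) (rule nv)
  have "((\<lambda>s. (\<Sum>k<N. cross2 (w s (int k)) (w s (int k + 1))) / 2) has_real_derivative
      (\<Sum>k<N. cross2 (u (int k)) (w t (int k + 1)) + cross2 (w t (int k)) (u (int k + 1))) / 2)
      (at t within I)"
    by (rule DERIV_cdivide, rule DERIV_sum, rule has_real_derivative_cross2) (rule velocities(1))+
  also have "(\<Sum>k<N. cross2 (u (int k)) (w t (int k + 1)) + cross2 (w t (int k)) (u (int k + 1))) / 2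
      = (\<Sum>k<N. edge_length (w t) (int k + 1) * V k)"
  proof (rule shoelace_rate_eq_flux)
    show "w t (int N) = w t 0"
      using is_polygon_periodic[OF poly[OF t], of 0] by simp
    fix k assume k: "k < N"
    have "outward_normal N w0 (int k + 1) = - \<i> * sgn (w t (int k + 1) - w t (int k))"
      using outward_normal_eq[OF poly[OF t] k] normal[OF t] by simp
    then show "u (int k) \<bullet> (- \<i> * sgn (w t (int k + 1) - w t (int k))) = V k"
      "u (int k + 1) \<bullet> (- \<i> * sgn (w t (int k + 1) - w t (int k))) = V k"
      using velocities(3)[OF k] by (simp_all only: V_def)
  qed (rule velocities(2))
  finally have "((\<lambda>s. measure lebesgue (inside (polygon_curve N (w s)))) has_real_derivative
      (\<Sum>k<N. edge_length (w t) (int k + 1) * V k)) (at t within I)"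
    unfolding has_field_derivative_def
    by (rule has_derivative_transform[OF t, rotated]) (rule shoelace_formula[OF poly])
  then show ?thesis
    using flux edge by (simp add: sum_edges)
qed

end
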